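(* Let $k,\ell$ be positive integers and let $T_{k,\ell}$ be the graph obtained from a cycle $C$ of length $3k$ with three vertices $v_1,v_2,v_3$ on $C$ pairwise at distance $k$ along $C$, by adding three vertex-disjoint paths $P_1,P_2,P_3$, each of length $\ell$, disjoint from $C$ except that one endpoint of $P_i$ is identified with $v_i$ for $i=1,2,3$. Then \[\rho(T_{k,\ell})=\max\left\{\left\lceil \frac{\ell}{2}+\frac{k-2}{4}\right\rceil,\ \left\lceil \frac{3k-2}{2}\right\rceil\right\}.\]
   Context: Patrol game with radius of capture $\rho\ge 0$ on a connected graph $G$: there is one cop and one robber. Before the game the cop fixes a walk in $G$ (his patrol: a sequence of vertices in which consecutive vertices are equal or adjacent), and the robber knows the entire patrol in advance, while the cop has no information about the robber. The cop starts at the first vertex of his patrol, then the robber chooses a starting vertex; afterwards the players alternate moves (cop first), the cop following his patrol and the robber moving to an adjacent vertex or staying put. The cop wins if at some moment the distance between the cop and the robber is at most $\rho$; otherwise the robber wins. $\rho(G)$ is the minimum $\rho\ge0$ for which the cop has a patrol capturing the robber regardless of the robber's play. Path length means number of edges. *)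

theory Defs
  imports Complex_Main "Graph_Theory.Graph_Theory"
begin

text \<open>
  Finite simple graphs are represented as in \<open>pair_graph\<close>: each edge is present as the two arcs
  \<open>(u, v)\<close> and \<open>(v, u)\<close>, so that arc walks are walks in the undirected graph.
\<close>

text \<open>The distance in \<open>G\<close>, i.e. the least number of edges of a walk from \<open>u\<close> to \<open>v\<close>
  (\<open>\<infinity>\<close> if there is none).\<close>

definition gdist :: "'a pair_pre_digraph \<Rightarrow> 'a \<Rightarrow> 'a \<Rightarrow> ereal" where
  "gdist G u v = wf_digraph.\<mu> (with_proj G) (\<lambda>_. 1) u v"

definition lazy_walk :: "'a pair_pre_digraph \<Rightarrow> (nat \<Rightarrow> 'a) \<Rightarrow> bool" where
  "lazy_walk G w \<longleftrightarrow>
     (\<forall>t. w t \<in> pverts G) \<and> (\<forall>t. w (Suc t) = w t \<or> (w t, w (Suc t)) \<in> parcs G)"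

text \<open>
  The cop follows \<open>c\<close> and the robber \<open>r\<close>. The positions occurring during the game are,
  in this order, \<open>(c 0, r 0)\<close>, \<open>(c 1, r 0)\<close>, \<open>(c 1, r 1)\<close>, \<open>(c 2, r 1)\<close> and so on.
\<close>

definition capture :: "'a pair_pre_digraph \<Rightarrow> nat \<Rightarrow> (nat \<Rightarrow> 'a) \<Rightarrow> (nat \<Rightarrow> 'a) \<Rightarrow> bool" where
  "capture G \<rho> c r \<longleftrightarrow>
     (\<exists>t. gdist G (c t) (r t) \<le> ereal (real \<rho>) \<or> gdist G (c (Suc t)) (r t) \<le> ereal (real \<rho>))"

text \<open>
  The robber knows the whole patrol \<open>c\<close> beforehand and the cop never reacts to the robber,
  so the possible plays of the robber against \<open>c\<close> are exactly the lazy walks.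
  Patrols are infinite; a finite one is represented by letting the cop stay at its last vertex.
\<close>

definition winning_patrol :: "'a pair_pre_digraph \<Rightarrow> nat \<Rightarrow> (nat \<Rightarrow> 'a) \<Rightarrow> bool" where
  "winning_patrol G \<rho> c \<longleftrightarrow> lazy_walk G c \<and> (\<forall>r. lazy_walk G r \<longrightarrow> capture G \<rho> c r)"

definition patrol_radius :: "'a pair_pre_digraph \<Rightarrow> nat" where
  "patrol_radius G = (LEAST \<rho>. \<exists>c. winning_patrol G \<rho> c)"

datatype tvertex = Cyc nat | Leg nat nat

text \<open>The \<open>t\<close>-th vertex, \<open>t \<le> \<ell>\<close>, of the path attached at the cycle vertex \<open>Cyc (j * k)\<close>,
  for \<open>j < 3\<close>; its vertex number \<open>0\<close> is identified with that cycle vertex.\<close>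

definition path_vertex :: "nat \<Rightarrow> nat \<Rightarrow> nat \<Rightarrow> tvertex" where
  "path_vertex k j t = (if t = 0 then Cyc (j * k) else Leg j t)"

definition T_edges :: "nat \<Rightarrow> nat \<Rightarrow> tvertex rel" where
  "T_edges k l =
     {(Cyc i, Cyc ((i + 1) mod (3 * k))) | i. i < 3 * k} \<union>
     {(path_vertex k j t, path_vertex k j (t + 1)) | j t. j < 3 \<and> t < l}"

definition T_graph :: "nat \<Rightarrow> nat \<Rightarrow> tvertex pair_pre_digraph" where
  "T_graph k l =
     \<lparr> pverts = {Cyc i | i. i < 3 * k} \<union> {path_vertex k j t | j t. j < 3 \<and> t \<le> l},
       parcs = T_edges k l \<union> (T_edges k l)\<inverse> \<rparr>"

lemma finite_T_edges: "finite (T_edges k l)"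
proof -
  have "T_edges k l = (\<lambda>i. (Cyc i, Cyc ((i + 1) mod (3 * k)))) ` {..<3 * k} \<union>
     (\<lambda>(j, t). (path_vertex k j t, path_vertex k j (t + 1))) ` ({..<3} \<times> {..<l})"
    unfolding T_edges_def by fast
  then show ?thesis by simp
qed

lemma finite_T_verts: "finite (pverts (T_graph k l))"
proof -
  have "pverts (T_graph k l) = Cyc ` {..<3 * k} \<union>
     (\<lambda>(j, t). path_vertex k j t) ` ({..<3} \<times> {..l})"
    unfolding T_graph_def by auto
  then show ?thesis by simp
qed

lemma T_edges_verts:
  assumes "k > 0" "(u, v) \<in> T_edges k l"
  shows "u \<in> pverts (T_graph k l)" "v \<in> pverts (T_graph k l)"
  using assms unfolding T_edges_def T_graph_def
  by (auto, (metis Suc_leI less_imp_le_nat)+)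

lemma T_edges_irrefl:
  assumes "k > 0" shows "(u, u) \<notin> T_edges k l"
proof
  assume "(u, u) \<in> T_edges k l"
  then obtain i where i: "i < 3 * k" "i = (i + 1) mod (3 * k)"
    by (auto simp: T_edges_def path_vertex_def split: if_splits)
  then show False
    using assms by (cases "i + 1 = 3 * k") auto
qed

lemma pair_graph_T_graph:
  assumes "k > 0"
  shows "pair_graph (T_graph k l)"
proof
  fix e assume "e \<in> parcs (T_graph k l)"
  then have "e \<in> T_edges k l \<or> (snd e, fst e) \<in> T_edges k l"
    by (cases e) (auto simp: T_graph_def)
  then show "fst e \<in> pverts (T_graph k l)" "snd e \<in> pverts (T_graph k l)" "fst e \<noteq> snd e"
    using T_edges_verts[OF assms] T_edges_irrefl[OF assms] by (metis prod.collapse)+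
next
  show "finite (pverts (T_graph k l))" by (rule finite_T_verts)
  show "finite (parcs (T_graph k l))" by (simp add: T_graph_def finite_T_edges)
  show "symmetric (with_proj (T_graph k l))"
    by (auto simp: symmetric_def T_graph_def intro!: symI)
qed

end

theory Submission
  imports Defs
begin

text \<open>
  Both bounds on the radius \<open>\<rho>\<close> are necessary. If \<open>2\<rho> + 3 \<le> 3k\<close>, a robber on the cycle stays
  opposite to the patrol's projection to the cycle. If \<open>4\<rho> + 3 \<le> 2l + k\<close>, the end of a leg is only
  searched from depth \<open>l - \<rho>\<close> or more; while the patrol is that deep in one leg, the part of the
  cycle within its reach is so small that a robber can run between the bases of the two other legs.
  Hence after each deep visit to a leg both other legs become contaminated, and a robber who knows
  the patrol evades it.

  Conversely, if both bounds hold, the patrol clears leg 2, then leg 0, then leg 1, descending to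
  depth \<open>l - \<rho>\<close> in each. A step along the cycle sees the whole cycle, because no vertex is farther
  than \<open>\<rho>\<close> from both of its ends; and during the visit to leg 0 the base of leg 1 or 2 is out of
  reach for too short a time for the robber to get from leg 1 to leg 2.
\<close>

section \<open>Distances, potentials and evasion in arbitrary graphs\<close>

definition step :: "'a pair_pre_digraph \<Rightarrow> 'a rel" where
  "step G = (parcs G)\<^sup>="

lemma lazy_walk_iff:
  "lazy_walk G w \<longleftrightarrow> (\<forall>t. w t \<in> pverts G) \<and> (\<forall>t. (w t, w (Suc t)) \<in> step G)"
  by (metis (no_types, lifting) UnE UnI1 UnI2 lazy_walk_def pair_in_Id_conv step_def)

text \<open>Dropping the stays from a lazy walk leaves an arc walk that is no longer. Upper bounds
  on distances are obtained in this way.\<close>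

lemma gdist_le:
  assumes "pair_wf_digraph G" "u \<in> pverts G" "(u, v) \<in> step G ^^ n"
  shows "gdist G u v \<le> ereal (real n)"
proof -
  interpret pair_wf_digraph G by fact
  have "\<exists>p. awalk u p v \<and> length p \<le> n"
    using assms(2,3)
  proof (induction n arbitrary: u)
    case 0
    then show ?case by (intro exI[of _ "[]"]) (auto simp: awalk_Nil_iff)
  next
    case (Suc n)
    obtain w where w: "(u, w) \<in> step G" "(w, v) \<in> step G ^^ n"
      using Suc.prems(2) by (meson relpow_Suc_D2)
    have "w \<in> pverts G" using w(1) Suc.prems(1) in_arcsD2[of u w] by (auto simp: step_def)
    then obtain p where p: "awalk w p v" "length p \<le> n" using Suc.IH w(2) by blast
    show ?case
    proof (cases "u = w")
      case True
      then show ?thesis using p by (intro exI[of _ p]) auto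
    next
      case False
      then have "(u, w) \<in> parcs G" using w by (auto simp: step_def)
      then show ?thesis using p
        by (intro exI[of _ "(u, w) # p"]) (auto simp: awalk_Cons_iff)
    qed
  qed
  then obtain p where p: "awalk u p v" "length p \<le> n" by blast
  have "awalk_cost (\<lambda>_. 1) p = real (length p)" by (induction p) auto
  then have "\<mu> (\<lambda>_. 1) u v \<le> ereal (real (length p))"
    using min_cost_le_walk_cost[OF p(1), of "\<lambda>_. 1"] by simp
  also have "\<dots> \<le> ereal (real n)" using p by simp
  finally show ?thesis by (simp add: gdist_def)
qed

text \<open>Such a potential bounds distances from below; every claim that the robber is out of
  reach rests on one.\<close>

definition arc_lipschitz :: "'a pair_pre_digraph \<Rightarrow> ('a \<Rightarrow> int) \<Rightarrow> bool" where
  "arc_lipschitz G f \<longleftrightarrow> (\<forall>(u, v) \<in> parcs G. \<bar>f u - f v\<bar> \<le> 1)"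

lemma gdist_ge:
  assumes "pair_wf_digraph G" "arc_lipschitz G f"
  shows "ereal (real_of_int \<bar>f u - f v\<bar>) \<le> gdist G u v"
proof -
  interpret pair_wf_digraph G by fact
  have "real_of_int \<bar>f u - f v\<bar> \<le> awalk_cost (\<lambda>_. 1) p" if "awalk u p v" for p
    using that
  proof (induction p arbitrary: u)
    case Nil
    then show ?case by (simp add: awalk_Nil_iff)
  next
    case (Cons e p)
    have "\<bar>f (fst e) - f (snd e)\<bar> \<le> 1" "u = fst e" "awalk (snd e) p v"
      using Cons.prems assms(2) by (auto simp: awalk_Cons_iff arc_lipschitz_def)
    then show ?case using Cons.IH[of "snd e"] by simp
  qed
  then show ?thesis unfolding gdist_def \<mu>_def by (auto intro!: INF_greatest)
qed

lemma lazy_walk_lipschitz: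
  assumes "lazy_walk G c" "arc_lipschitz G f"
  shows "\<bar>f (c (m + i)) - f (c m)\<bar> \<le> int i"
proof (induction i)
  case (Suc i)
  have "\<bar>f (c (m + Suc i)) - f (c (m + i))\<bar> \<le> 1"
    using assms unfolding lazy_walk_def arc_lipschitz_def
    by (metis (no_types, lifting) abs_minus_commute add_Suc_right cancel_comm_monoid_add_class.diff_cancel
        case_prod_conv abs_zero zero_le_one)
  then show ?case using Suc by linarith
qed simp

section \<open>Finite safe walks and their infinite limits\<close>

definition safe_upto :: "'a pair_pre_digraph \<Rightarrow> (nat \<Rightarrow> 'a \<Rightarrow> bool) \<Rightarrow> nat \<Rightarrow> (nat \<Rightarrow> 'a) \<Rightarrow> bool" where
  "safe_upto G S n r \<longleftrightarrow> (\<forall>t\<le>n. r t \<in> pverts G \<and> S t (r t)) \<and> (\<forall>t<n. (r t, r (Suc t)) \<in> step G)"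

definition reachable_safely :: "'a pair_pre_digraph \<Rightarrow> (nat \<Rightarrow> 'a \<Rightarrow> bool) \<Rightarrow> nat \<Rightarrow> 'a \<Rightarrow> bool" where
  "reachable_safely G S n v \<longleftrightarrow> (\<exists>r. safe_upto G S n r \<and> r n = v)"

lemma reachable_safely_0:
  "v \<in> pverts G \<Longrightarrow> S 0 v \<Longrightarrow> reachable_safely G S 0 v"
  unfolding reachable_safely_def safe_upto_def by (auto intro!: exI[of _ "\<lambda>_. v"])

lemma reachable_safely_Suc:
  assumes "reachable_safely G S n u" "(u, v) \<in> step G" "v \<in> pverts G" "S (Suc n) v"
  shows "reachable_safely G S (Suc n) v"
proof -
  obtain r where r: "safe_upto G S n r" "r n = u"
    using assms(1) unfolding reachable_safely_def by blast
  have "safe_upto G S (Suc n) (r(Suc n := v))"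
    using r assms unfolding safe_upto_def by (auto simp: le_Suc_eq less_Suc_eq)
  then show ?thesis unfolding reachable_safely_def by (intro exI[of _ "r(Suc n := v)"]) simp
qed

text \<open>Koenig's lemma on the finite vertex set: follow vertices that lie on arbitrarily long
  safe walks. This reduces evasion to reaching some vertex safely at each time.\<close>

lemma koenig_safe_walk:
  assumes fin: "finite (pverts G)" and reach: "\<And>n. \<exists>v. reachable_safely G S n v"
  obtains r where "lazy_walk G r" "\<And>t. S t (r t)"
proof -
  define E where "E n v \<longleftrightarrow> (\<forall>N\<ge>n. \<exists>r. safe_upto G S N r \<and> r n = v)" for n v
  have mono: "safe_upto G S N r" if "safe_upto G S M r" "N \<le> M" for N M r
    using that unfolding safe_upto_def by auto
  have pigeon: "\<exists>v\<in>pverts G. \<forall>N. P N v"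
    if ex: "\<And>N. \<exists>v\<in>pverts G. P N v" and anti: "\<And>N M v. P M v \<Longrightarrow> N \<le> M \<Longrightarrow> P N v"
    for P :: "nat \<Rightarrow> 'a \<Rightarrow> bool"
  proof (rule ccontr)
    assume "\<not> ?thesis"
    \<comment> \<open>Otherwise each vertex fails at some horizon, and the largest of these defeats
      all vertices at once, since \<open>P\<close> is antitone in the horizon.\<close>
    then obtain N where N: "\<And>v. v \<in> pverts G \<Longrightarrow> \<not> P (N v) v" by metis
    obtain v where v: "v \<in> pverts G" "P (Max (N ` pverts G)) v" using ex by blast
    have "N v \<le> Max (N ` pverts G)" using fin v(1) by simp
    then show False using N anti v by blast
  qed
  have start: "\<exists>v. E 0 v"
  proof -
    have "\<exists>v\<in>pverts G. \<forall>N. \<exists>r. safe_upto G S N r \<and> r 0 = v"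
    proof (intro pigeon)
      show "\<exists>v\<in>pverts G. \<exists>r. safe_upto G S N r \<and> r 0 = v" for N
        using reach[of N] unfolding reachable_safely_def safe_upto_def by blast
    qed (use mono in blast)
    then show ?thesis unfolding E_def by blast
  qed
  have next_ex: "\<exists>w. E (Suc n) w \<and> (v, w) \<in> step G" if Env: "E n v" for n v
  proof -
    \<comment> \<open>Only walks already passing through \<open>v\<close> are considered, so that
      \<open>w\<close> is a successor of \<open>v\<close> and not merely a good vertex for the next
      time.\<close>
    have "\<exists>w\<in>pverts G. \<forall>N. \<exists>r. safe_upto G S (Suc n + N) r \<and> r n = v \<and> r (Suc n) = w"
    proof (intro pigeon)
      fix N
      obtain r where r: "safe_upto G S (Suc n + N) r" "r n = v"
        using Env unfolding E_def by (auto dest: spec[of _ "Suc n + N"])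
      then show "\<exists>w\<in>pverts G. \<exists>r. safe_upto G S (Suc n + N) r \<and> r n = v \<and> r (Suc n) = w"
        by (intro bexI[of _ "r (Suc n)"] exI[of _ r]) (auto simp: safe_upto_def)
    next
      fix N M w
      assume "\<exists>r. safe_upto G S (Suc n + M) r \<and> r n = v \<and> r (Suc n) = w" "N \<le> M"
      then show "\<exists>r. safe_upto G S (Suc n + N) r \<and> r n = v \<and> r (Suc n) = w"
        using mono[of "Suc n + M" _ "Suc n + N"] by auto
    qed
    then obtain w where w: "\<And>N. \<exists>r. safe_upto G S (Suc n + N) r \<and> r n = v \<and> r (Suc n) = w" by blast
    have "E (Suc n) w"
      unfolding E_def
    proof (intro allI impI)
      fix N assume "Suc n \<le> N"
      then show "\<exists>r. safe_upto G S N r \<and> r (Suc n) = w"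
        using w[of "N - Suc n"] by auto
    qed
    moreover have "(v, w) \<in> step G" using w[of 0] unfolding safe_upto_def by auto
    ultimately show ?thesis by blast
  qed
  obtain r where r: "\<And>n. E n (r n)" "\<And>n. (r n, r (Suc n)) \<in> step G"
    using dependent_nat_choice[of E "\<lambda>_ v w. (v, w) \<in> step G"] start next_ex by auto
  have "r n \<in> pverts G \<and> S n (r n)" for n
    using r(1)[of n, unfolded E_def, rule_format, OF order_refl]
    by (auto simp: safe_upto_def)
  moreover have "lazy_walk G r"
    using r(2) calculation by (simp add: lazy_walk_iff)
  ultimately show thesis using that by blast
qed

section \<open>The cycle with three legs\<close>

lemma path_vertex_0 [simp]: "path_vertex k j 0 = Cyc (j * k)"
  and path_vertex_pos [simp]: "0 < t \<Longrightarrow> path_vertex k j t = Leg j t"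
  by (simp_all add: path_vertex_def)

definition cyc_dist :: "nat \<Rightarrow> nat \<Rightarrow> nat \<Rightarrow> int" where
  "cyc_dist n a b = min \<bar>int a - int b\<bar> (int n - \<bar>int a - int b\<bar>)"

definition cyc_adj :: "nat \<Rightarrow> nat \<Rightarrow> nat \<Rightarrow> bool" where
  "cyc_adj n a b \<longleftrightarrow> b = Suc a \<or> a = Suc b \<or> a = 0 \<and> Suc b = n \<or> b = 0 \<and> Suc a = n"

lemma cyc_adj_sym: "cyc_adj n a b \<longleftrightarrow> cyc_adj n b a"
  by (auto simp: cyc_adj_def)

lemma cyc_adj_Suc_mod: "a < n \<Longrightarrow> cyc_adj n a (Suc a mod n)"
  by (auto simp: cyc_adj_def mod_Suc)

lemma cyc_dist_lipschitz:
  assumes "cyc_adj n a b" "a < n" "b < n" "x < n"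
  shows "\<bar>cyc_dist n x a - cyc_dist n x b\<bar> \<le> 1"
  using assms unfolding cyc_dist_def cyc_adj_def by (elim disjE conjE; simp add: min_def abs_if)

lemma cyc_dist_nonneg: "a < n \<Longrightarrow> b < n \<Longrightarrow> 0 \<le> cyc_dist n a b"
  by (simp add: cyc_dist_def)

text \<open>The depth in leg \<open>j\<close>, continued outside that leg by minus the distance to its base.\<close>

fun signed_depth :: "nat \<Rightarrow> nat \<Rightarrow> tvertex \<Rightarrow> int" where
  "signed_depth k j (Cyc a) = - cyc_dist (3 * k) (j * k) a"
| "signed_depth k j (Leg i q) = (if i = j then int q else - (int k + int q))"

text \<open>The retraction onto the cycle. It does not increase distances, so a robber on the cycle
  who is far from the projection is far from the patrol.\<close>

fun cyc_proj :: "nat \<Rightarrow> tvertex \<Rightarrow> nat" where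
  "cyc_proj k (Cyc a) = a"
| "cyc_proj k (Leg i q) = i * k"

locale cycle_with_legs =
  fixes k l :: nat
  assumes k_pos: "k > 0"
begin

abbreviation "G \<equiv> T_graph k l"

lemma pair_wf_T: "pair_wf_digraph G"
  using pair_graph_T_graph[OF k_pos, of l]
  by (simp add: pair_graph_def pair_digraph_def pair_fin_digraph_def)

lemma leg_base_less: "j < 3 \<Longrightarrow> j * k < 3 * k"
  using k_pos by simp

lemma cyc_dist_leg_bases:
  assumes "i < 3" "j < 3" "i \<noteq> j"
  shows "cyc_dist (3 * k) (i * k) (j * k) = int k"
proof -
  have "i = 0 \<or> i = 1 \<or> i = 2" "j = 0 \<or> j = 1 \<or> j = 2" using assms by auto
  then show ?thesis using assms(3) by (auto simp: cyc_dist_def)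
qed

lemma cyc_dist_same [simp]: "cyc_dist n a a = 0"
  by (simp add: cyc_dist_def)

lemma cyc_in_verts: "a < 3 * k \<Longrightarrow> Cyc a \<in> pverts G"
  by (auto simp: T_graph_def)

lemma path_vertex_in_verts: "j < 3 \<Longrightarrow> t \<le> l \<Longrightarrow> path_vertex k j t \<in> pverts G"
  by (auto simp: T_graph_def)

lemma T_verts_cases:
  assumes "v \<in> pverts G"
  obtains (Cyc) a where "v = Cyc a" "a < 3 * k"
  | (Leg) j q where "v = Leg j q" "j < 3" "0 < q" "q \<le> l"
proof -
  consider a where "v = Cyc a" "a < 3 * k" | j t where "v = path_vertex k j t" "j < 3" "t \<le> l"
    using assms unfolding T_graph_def by auto
  then show thesis
    using Cyc Leg leg_base_less by cases (auto simp: path_vertex_def split: if_splits)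
qed

text \<open>Writing the end nearer to the base as \<open>path_vertex\<close> treats the arc at the
  base, where \<open>t = 0\<close>, like the inner arcs of a leg.\<close>

lemma T_arc_cases:
  assumes "(u, v) \<in> parcs G"
  obtains (Cyc) a b where "u = Cyc a" "v = Cyc b" "a < 3 * k" "b < 3 * k" "cyc_adj (3 * k) a b"
  | (out) j t where "u = path_vertex k j t" "v = Leg j (Suc t)" "j < 3" "t < l"
  | ("in") j t where "v = path_vertex k j t" "u = Leg j (Suc t)" "j < 3" "t < l"
proof -
  have adj: "cyc_adj (3 * k) a ((a + 1) mod (3 * k))" "cyc_adj (3 * k) ((a + 1) mod (3 * k)) a"
    "(a + 1) mod (3 * k) < 3 * k" if "a < 3 * k" for a
    using cyc_adj_Suc_mod[OF that] cyc_adj_sym that by auto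
  consider a where "u = Cyc a" "v = Cyc ((a + 1) mod (3 * k))" "a < 3 * k"
    | a where "v = Cyc a" "u = Cyc ((a + 1) mod (3 * k))" "a < 3 * k"
    | j t where "u = path_vertex k j t" "v = path_vertex k j (t + 1)" "j < 3" "t < l"
    | j t where "v = path_vertex k j t" "u = path_vertex k j (t + 1)" "j < 3" "t < l"
    using assms unfolding T_graph_def T_edges_def by auto
  then show thesis
  proof cases
    case (1 a)
    show ?thesis using Cyc[OF 1(1,2,3)] adj 1(3) by blast
  next
    case (2 a)
    show ?thesis using Cyc[OF 2(2,1)] adj 2(3) by blast
  next
    case (3 j t)
    then show ?thesis using out[of j t] by simp
  next
    case (4 j t)
    then show ?thesis using "in"[of j t] by simp
  qed
qed

lemma step_refl: "(u, u) \<in> step G"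
  by (simp add: step_def)

lemma step_sym: "(u, v) \<in> step G \<Longrightarrow> (v, u) \<in> step G"
  by (auto simp: step_def T_graph_def)

lemma step_cyc:
  assumes "cyc_adj (3 * k) a b" "a < 3 * k" "b < 3 * k"
  shows "(Cyc a, Cyc b) \<in> step G"
proof -
  have *: "(Cyc a, Cyc (Suc a mod (3 * k))) \<in> step G" if "a < 3 * k" for a
    using that by (auto simp: step_def T_graph_def T_edges_def)
  consider "b = Suc a mod (3 * k)" | "a = Suc b mod (3 * k)"
    using assms unfolding cyc_adj_def by (auto simp: mod_Suc)
  then show ?thesis using * step_sym assms by cases auto
qed

lemma step_leg:
  assumes "j < 3" "t < l"
  shows "(path_vertex k j t, path_vertex k j (Suc t)) \<in> step G"
  using assms unfolding step_def T_graph_def T_edges_def by fastforce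

lemma step_from_Leg:
  assumes "(Leg j q, w) \<in> step G"
  shows "(\<exists>q'. w = Leg j q') \<or> w = Cyc (j * k)"
  using assms unfolding step_def
  by (auto elim!: T_arc_cases simp: path_vertex_def split: if_splits)

lemma step_from_Cyc:
  assumes "(Cyc a, w) \<in> step G"
  shows "w = Cyc a \<or> (\<exists>b<3 * k. w = Cyc b \<and> cyc_adj (3 * k) a b) \<or> (\<exists>j<3. a = j * k \<and> w = Leg j 1)"
  using assms unfolding step_def
  by (auto elim!: T_arc_cases simp: path_vertex_def split: if_splits)

text \<open>On another leg the potential continues from its value \<open>- k\<close> at that leg's
  base, as the bases have pairwise cyclic distance \<open>k\<close>.\<close>

lemma arc_lipschitz_signed_depth:
  assumes "j < 3"
  shows "arc_lipschitz G (signed_depth k j)"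
proof -
  have leg: "\<bar>signed_depth k j (path_vertex k i t) - signed_depth k j (Leg i (Suc t))\<bar> \<le> 1" if "i < 3" for i t
    using cyc_dist_leg_bases[OF assms that] by (cases "i = j") (auto simp: path_vertex_def)
  have "\<bar>signed_depth k j u - signed_depth k j v\<bar> \<le> 1" if "(u, v) \<in> parcs G" for u v
    using that
  proof (cases rule: T_arc_cases)
    case (Cyc a b)
    then show ?thesis using cyc_dist_lipschitz[of "3 * k" a b "j * k"] leg_base_less[OF assms] by simp
  next
    case (out i t)
    then show ?thesis using leg[of i t] by simp
  next
    case ("in" i t)
    then show ?thesis using leg[of i t] by simp
  qed
  then show ?thesis by (auto simp: arc_lipschitz_def)
qed

lemma cyc_proj_less: "v \<in> pverts G \<Longrightarrow> cyc_proj k v < 3 * k"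
  using leg_base_less by (auto elim!: T_verts_cases)

lemma cyc_proj_arc:
  assumes "(u, v) \<in> step G"
  shows "cyc_proj k u = cyc_proj k v \<or> cyc_adj (3 * k) (cyc_proj k u) (cyc_proj k v)"
  using assms unfolding step_def
  by (auto elim!: T_arc_cases simp: path_vertex_def split: if_splits)

lemma arc_lipschitz_cyc_dist:
  assumes "a < 3 * k"
  shows "arc_lipschitz G (\<lambda>v. cyc_dist (3 * k) a (cyc_proj k v))"
proof -
  have "\<bar>cyc_dist (3 * k) a (cyc_proj k u) - cyc_dist (3 * k) a (cyc_proj k v)\<bar> \<le> 1"
    if "(u, v) \<in> parcs G" for u v
  proof -
    interpret pair_wf_digraph G by (rule pair_wf_T)
    have "u \<in> pverts G" "v \<in> pverts G" using that in_arcsD1 in_arcsD2 by auto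
    then show ?thesis
      using that cyc_proj_arc[of u v] cyc_dist_lipschitz[OF _ _ _ assms] cyc_proj_less
      by (auto simp: step_def)
  qed
  then show ?thesis by (auto simp: arc_lipschitz_def)
qed

section \<open>Explicit walks and upper bounds on distances\<close>

lemma relpow_step_mono:
  assumes "(u, v) \<in> step G ^^ m" "m \<le> n"
  shows "(u, v) \<in> step G ^^ n"
  using assms(2,1)
proof (induction rule: dec_induct)
  case (step i)
  then show ?case using step_refl by auto
qed

lemma relpow_step_sym: "(u, v) \<in> step G ^^ n \<Longrightarrow> (v, u) \<in> step G ^^ n"
proof (induction n arbitrary: v)
  case (Suc n)
  then obtain w where "(u, w) \<in> step G ^^ n" "(w, v) \<in> step G" by auto
  then show ?case using Suc.IH step_sym by (meson relpow_Suc_I2)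
qed auto

lemma relpow_step_cyc_forward:
  assumes "a < 3 * k"
  shows "(Cyc a, Cyc ((a + m) mod (3 * k))) \<in> step G ^^ m"
proof (induction m)
  case (Suc m)
  have "cyc_adj (3 * k) ((a + m) mod (3 * k)) ((a + Suc m) mod (3 * k))"
    using cyc_adj_Suc_mod[of "(a + m) mod (3 * k)" "3 * k"] k_pos by (simp add: mod_Suc_eq)
  then have "(Cyc ((a + m) mod (3 * k)), Cyc ((a + Suc m) mod (3 * k))) \<in> step G"
    using k_pos by (intro step_cyc) auto
  then show ?case using Suc by auto
qed (use assms in simp)

lemma relpow_step_cyc:
  assumes "a < 3 * k" "b < 3 * k" "cyc_dist (3 * k) a b \<le> int m"
  shows "(Cyc a, Cyc b) \<in> step G ^^ m"
proof -
  have *: "(Cyc a, Cyc b) \<in> step G ^^ m"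
    if "a \<le> b" "a < 3 * k" "b < 3 * k" "cyc_dist (3 * k) a b \<le> int m" for a b
  proof (cases "b - a \<le> m")
    case True
    then show ?thesis
      using relpow_step_mono[OF relpow_step_cyc_forward[OF that(2), of "b - a"], of m] that by simp
  next
    case False
    then have "3 * k - b + a \<le> m" using that by (auto simp: cyc_dist_def)
    moreover have "(Cyc b, Cyc a) \<in> step G ^^ (3 * k - b + a)"
      using relpow_step_cyc_forward[OF that(3), of "3 * k - b + a"] that by simp
    ultimately show ?thesis by (meson relpow_step_sym relpow_step_mono)
  qed
  have "cyc_dist (3 * k) a b = cyc_dist (3 * k) b a"
    by (simp add: cyc_dist_def abs_minus_commute)
  then show ?thesis using *[of a b] *[of b a] relpow_step_sym assms by (cases "a \<le> b") auto
qed

lemma relpow_step_leg: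
  assumes "j < 3" "t \<le> t'" "t' \<le> l"
  shows "(path_vertex k j t, path_vertex k j t') \<in> step G ^^ (t' - t)"
  using assms(2,3)
proof (induction rule: dec_induct)
  case (step n)
  have "(path_vertex k j n, path_vertex k j (Suc n)) \<in> step G"
    using step step_leg[OF assms(1), of n] by simp
  then have "(path_vertex k j t, path_vertex k j (Suc n)) \<in> step G ^^ Suc (n - t)"
    using step by auto
  then show ?case using step by (simp only: Suc_diff_le)
qed auto

lemma gdist_leg_leg:
  assumes j: "j < 3" and t: "t \<le> l" "t' \<le> l" "t \<le> t' + \<rho>" "t' \<le> t + \<rho>"
  shows "gdist G (path_vertex k j t) (path_vertex k j t') \<le> ereal (real \<rho>)"
proof -
  have "(path_vertex k j t, path_vertex k j t') \<in> step G ^^ \<rho>"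
  proof (cases "t \<le> t'")
    case True
    show ?thesis
      by (rule relpow_step_mono[OF relpow_step_leg[OF j True t(2)]]) (use t in simp)
  next
    case False
    then have "t' \<le> t" by simp
    show ?thesis
      by (rule relpow_step_mono[OF relpow_step_sym[OF relpow_step_leg[OF j \<open>t' \<le> t\<close> t(1)]]])
        (use t in simp)
  qed
  then show ?thesis by (rule gdist_le[OF pair_wf_T path_vertex_in_verts[OF j t(1)]])
qed

lemma gdist_leg_cyc:
  assumes "j < 3" "t \<le> l" "b < 3 * k" "int t + cyc_dist (3 * k) (j * k) b \<le> int \<rho>"
  shows "gdist G (path_vertex k j t) (Cyc b) \<le> ereal (real \<rho>)"
proof -
  have nonneg: "0 \<le> cyc_dist (3 * k) (j * k) b"
    using assms leg_base_less[OF assms(1)] by (intro cyc_dist_nonneg) auto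
  have "(path_vertex k j t, Cyc (j * k)) \<in> step G ^^ t"
    using relpow_step_sym[OF relpow_step_leg[of j 0 t]] assms by simp
  moreover have "(Cyc (j * k), Cyc b) \<in> step G ^^ (\<rho> - t)"
  proof (rule relpow_step_cyc)
    show "cyc_dist (3 * k) (j * k) b \<le> int (\<rho> - t)" using assms nonneg by linarith
  qed (use assms leg_base_less in auto)
  moreover have "t + (\<rho> - t) = \<rho>"
    using assms nonneg by linarith
  ultimately have "(path_vertex k j t, Cyc b) \<in> step G ^^ \<rho>"
    using relpow_add[of t "\<rho> - t" "step G"] by (metis relcompI)
  then show ?thesis by (rule gdist_le[OF pair_wf_T path_vertex_in_verts[OF assms(1,2)]])
qed

lemma gdist_cyc_cyc:
  assumes "a < 3 * k" "b < 3 * k" "cyc_dist (3 * k) a b \<le> int \<rho>"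
  shows "gdist G (Cyc a) (Cyc b) \<le> ereal (real \<rho>)"
  by (rule gdist_le[OF pair_wf_T cyc_in_verts[OF assms(1)] relpow_step_cyc[OF assms]])

end

section \<open>Evasion on the cycle\<close>

context cycle_with_legs
begin

lemma gdist_gt:
  assumes "arc_lipschitz G f" "int \<rho> < \<bar>f u - f v\<bar>"
  shows "\<not> gdist G u v \<le> ereal (real \<rho>)"
proof
  assume "gdist G u v \<le> ereal (real \<rho>)"
  then have "ereal (real_of_int \<bar>f u - f v\<bar>) \<le> ereal (real \<rho>)"
    using gdist_ge[OF pair_wf_T assms(1), of u v] by (rule order_trans[rotated])
  then show False using assms(2) by simp
qed

lemma cyc_dist_shift:
  assumes "x < n" "Suc \<rho> \<le> m" "m + Suc \<rho> \<le> n"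
  shows "int \<rho> < cyc_dist n ((x + m) mod n) x"
proof (cases "x + m < n")
  case True
  then show ?thesis using assms by (auto simp: cyc_dist_def)
next
  case False
  then have "(x + m) mod n = x + m - n" using assms by (simp add: mod_if)
  then show ?thesis using assms False by (auto simp: cyc_dist_def)
qed

text \<open>The robber keeps \<open>\<rho> + 1\<close> vertices ahead of the more advanced of the
  patrol's current and next projections. His offsets from these are \<open>\<rho> + 1\<close> or
  \<open>\<rho> + 2\<close>, and \<open>2 * \<rho> + 3 \<le> 3 * k\<close> makes the way round the
  cycle long enough as well.\<close>

lemma not_winning_if_small_on_cycle:
  assumes small: "2 * \<rho> + 3 \<le> 3 * k"
  shows "\<not> winning_patrol G \<rho> c"
proof
  assume win: "winning_patrol G \<rho> c"
  then have c: "lazy_walk G c" by (simp add: winning_patrol_def)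
  define n where "n = 3 * k"
  define x where "x t = cyc_proj k (c t)" for t
  \<comment> \<open>\<open>r t\<close> must avoid the patrol at times \<open>t\<close> and
    \<open>t + 1\<close>; \<open>M t\<close> is the more advanced of the two projections.\<close>
  define M where "M t = (if x (Suc t) = Suc (x t) mod n then x (Suc t) else x t)" for t
  define r where "r t = Cyc ((M t + Suc \<rho>) mod n)" for t
  have n: "0 < n" "2 * \<rho> + 3 \<le> n" using k_pos small by (auto simp: n_def)
  have x_less: "x t < n" for t
    using c cyc_proj_less by (auto simp: x_def n_def lazy_walk_def)
  have x_step: "x t = x (Suc t) \<or> x (Suc t) = Suc (x t) mod n \<or> x t = Suc (x (Suc t)) mod n" for t
  proof -
    have "(c t, c (Suc t)) \<in> step G" using c by (simp add: lazy_walk_iff)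
    then have "x t = x (Suc t) \<or> cyc_adj n (x t) (x (Suc t))"
      using cyc_proj_arc by (simp add: x_def n_def)
    then show ?thesis using x_less[of t] x_less[of "Suc t"] by (auto simp: cyc_adj_def mod_Suc)
  qed
  have M: "M t = x t \<or> M t = Suc (x t) mod n" "M t = x (Suc t) \<or> M t = Suc (x (Suc t)) mod n" for t
    using x_step[of t] by (auto simp: M_def)
  have far: "\<not> gdist G (c t) (Cyc ((m + Suc \<rho>) mod n)) \<le> ereal (real \<rho>)"
    if "m = x t \<or> m = Suc (x t) mod n" for m t
  proof -
    let ?b = "(m + Suc \<rho>) mod n"
    have "?b = (x t + Suc \<rho>) mod n \<or> ?b = (x t + Suc (Suc \<rho>)) mod n"
      using that mod_add_left_eq[of "Suc (x t)" n "Suc \<rho>"] by auto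
    then have "int \<rho> < cyc_dist n ?b (x t)"
      using cyc_dist_shift[OF x_less[of t], of \<rho> "Suc \<rho>"]
        cyc_dist_shift[OF x_less[of t], of \<rho> "Suc (Suc \<rho>)"] n by auto
    moreover have "?b < 3 * k" using n by (simp add: n_def)
    ultimately show ?thesis
      by (intro gdist_gt[OF arc_lipschitz_cyc_dist[of ?b]]) (simp_all add: x_def n_def)
  qed
  have "lazy_walk G r"
    unfolding lazy_walk_iff
  proof (intro conjI allI)
    fix t
    show "r t \<in> pverts G" using n by (auto simp: r_def n_def intro!: cyc_in_verts)
    \<comment> \<open>\<open>M t\<close> and \<open>M (Suc t)\<close> are each
      \<open>x (Suc t)\<close> or its successor, so both robber positions lie on the edge from
      \<open>b\<close> to its successor.\<close>
    define b where "b = (x (Suc t) + Suc \<rho>) mod n"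
    have "b < n" using n by (simp add: b_def)
    have shift: "(Suc (x (Suc t)) mod n + Suc \<rho>) mod n = Suc b mod n"
      using mod_add_left_eq[of "Suc (x (Suc t))" n "Suc \<rho>"] by (simp add: b_def mod_Suc_eq)
    have "(Cyc b, Cyc (Suc b mod n)) \<in> step G"
      using step_cyc[of b "Suc b mod n"] cyc_adj_Suc_mod[OF \<open>b < n\<close>] \<open>b < n\<close> n
      by (simp add: n_def)
    moreover have "r t = Cyc b \<or> r t = Cyc (Suc b mod n)"
      using M(2)[of t] shift b_def unfolding r_def by metis
    moreover have "r (Suc t) = Cyc b \<or> r (Suc t) = Cyc (Suc b mod n)"
      using M(1)[of "Suc t"] shift b_def unfolding r_def by metis
    ultimately show "(r t, r (Suc t)) \<in> step G"
      using step_sym[of "Cyc b" "Cyc (Suc b mod n)"] step_refl by auto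
  qed
  then have "capture G \<rho> c r" using win by (simp add: winning_patrol_def)
  then show False
    using far M unfolding capture_def r_def by blast
qed

text \<open>The robber's route between two legs while the patrol is in leg \<open>i\<close>: of the
  two arcs from base \<open>h\<close> to base \<open>j\<close>, the one that misses base
  \<open>i\<close>.\<close>

lemma opposite_arc:
  assumes "i < 3" "j < 3" "h < 3" "i \<noteq> j" "i \<noteq> h" "j \<noteq> h"
  obtains f where "f 0 = Cyc (h * k)" "f k = Cyc (j * k)"
    "\<And>x. x < k \<Longrightarrow> (f x, f (Suc x)) \<in> step G"
    "\<And>x. x \<le> k \<Longrightarrow> f x \<in> pverts G \<and> signed_depth k i (f x) \<le> - int k"
proof -
  define arc where "arc h x = Cyc ((h * k + x) mod (3 * k))" for h x
  have arc_0: "arc h 0 = Cyc (h * k)" if "h < 3" for h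
    using leg_base_less[OF that] by (simp add: arc_def)
  have arc_step: "(arc h x, arc h (Suc x)) \<in> step G" for h x
    using step_cyc[OF cyc_adj_Suc_mod, of "(h * k + x) mod (3 * k)"] k_pos
    by (simp add: arc_def mod_Suc_eq)
  have arc_verts: "arc h x \<in> pverts G" for h x
    using k_pos by (auto simp: arc_def intro: cyc_in_verts)
  \<comment> \<open>Indices along this arc increase cyclically either from \<open>h\<close> to
    \<open>j\<close>, or from \<open>j\<close> to \<open>h\<close>; in the second case it is
    traversed backwards.\<close>
  have next_cases: "(i, h, j) \<in> {(2, 0, 1), (0, 1, 2), (1, 2, 0)} \<or> (i, j, h) \<in> {(2, 0, 1), (0, 1, 2), (1, 2, 0)}"
  proof -
    have "i = 0 \<or> i = 1 \<or> i = 2" "j = 0 \<or> j = 1 \<or> j = 2" "h = 0 \<or> h = 1 \<or> h = 2"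
      using assms(1-3) by auto
    then show ?thesis using assms(4-6) by (elim disjE) simp_all
  qed
  have fwd: "arc h k = Cyc (j * k)" "x \<le> k \<Longrightarrow> signed_depth k i (arc h x) \<le> - int k"
    if ihj: "(i, h, j) \<in> {(2, 0, 1), (0, 1, 2), (1, 2, 0)}" for i h j x :: nat
  proof -
    show "arc h k = Cyc (j * k)" using ihj k_pos by (auto simp: arc_def)
    assume x: "x \<le> k"
    consider "i = 2" "h = 0" | "i = 0" "h = 1" | "i = 1" "h = 2" using ihj by auto
    then show "signed_depth k i (arc h x) \<le> - int k"
    proof cases
      case 1
      then have "arc h x = Cyc x" using x k_pos by (simp add: arc_def)
      then show ?thesis using x 1 by (simp add: cyc_dist_def)
    next
      case 2
      then have "arc h x = Cyc (k + x)" using x k_pos by (simp add: arc_def)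
      then show ?thesis using x 2 by (simp add: cyc_dist_def)
    next
      case 3
      then have "arc h x = Cyc (if x = k then 0 else 2 * k + x)" using x k_pos by (simp add: arc_def)
      then show ?thesis using x 3 by (simp add: cyc_dist_def)
    qed
  qed
  from next_cases show thesis
  proof
    assume *: "(i, h, j) \<in> {(2, 0, 1), (0, 1, 2), (1, 2, 0)}"
    show thesis
      by (rule that[of "arc h"]) (use arc_0 arc_step arc_verts fwd[OF *] assms in auto)
  next
    assume *: "(i, j, h) \<in> {(2, 0, 1), (0, 1, 2), (1, 2, 0)}"
    have "(arc j (k - x), arc j (k - Suc x)) \<in> step G" if "x < k" for x
      using step_sym[OF arc_step[of j "k - Suc x"]] that by (simp add: Suc_diff_Suc)
    then show thesis
      by (intro that[of "\<lambda>x. arc j (k - x)"]) (use arc_0 arc_verts fwd[OF *] assms in auto)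
  qed
qed

end

section \<open>Evasion between the legs\<close>

locale long_legs_patrol = cycle_with_legs +
  fixes \<rho> :: nat and c :: "nat \<Rightarrow> tvertex"
  assumes patrol: "lazy_walk G c"
    and radius_less: "4 * \<rho> + 3 \<le> 2 * l + k"
    and radius_ge: "3 * k \<le> 2 * \<rho> + 2"
begin

definition depth :: "nat \<Rightarrow> nat \<Rightarrow> int" where
  "depth j t = signed_depth k j (c t)"

text \<open>The signed depth is \<open>l\<close> minus the distance to the end of the leg, so at
  these times that end is within \<open>\<rho>\<close> of the patrol.\<close>

definition deep :: "nat \<Rightarrow> nat \<Rightarrow> bool" where
  "deep j t \<longleftrightarrow> int l - int \<rho> \<le> depth j t"

definition uncaught :: "nat \<Rightarrow> tvertex \<Rightarrow> bool" where
  "uncaught t v \<longleftrightarrow>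
     \<not> gdist G (c t) v \<le> ereal (real \<rho>) \<and> \<not> gdist G (c (Suc t)) v \<le> ereal (real \<rho>)"

text \<open>The depth of the vertex of leg \<open>j\<close> nearest to its base that is out of reach of the patrol at times \<open>t\<close>
  and \<open>t + 1\<close>; it is \<open>0\<close> if the base itself is out of reach.\<close>

definition hide_depth :: "nat \<Rightarrow> nat \<Rightarrow> nat" where
  "hide_depth j t = nat (max (depth j t) (depth j (Suc t)) + int \<rho> + 1)"

abbreviation "hide j t \<equiv> path_vertex k j (hide_depth j t)"

lemma radius_less_leg: "\<rho> < l"
  using radius_less radius_ge by linarith

lemma depth_lipschitz: "j < 3 \<Longrightarrow> \<bar>depth j (m + i) - depth j m\<bar> \<le> int i"
  using lazy_walk_lipschitz[OF patrol arc_lipschitz_signed_depth] by (simp add: depth_def)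

lemma depth_lipschitz':
  assumes "j < 3"
  shows "\<bar>depth j t - depth j u\<bar> \<le> \<bar>int t - int u\<bar>"
proof (cases "t \<le> u")
  case True
  then show ?thesis using depth_lipschitz[OF assms, of t "u - t"] by auto
next
  case False
  then show ?thesis using depth_lipschitz[OF assms, of u "t - u"] by auto
qed

lemma depth_other_leg:
  assumes "0 < depth j t" "j < 3" "i < 3" "i \<noteq> j"
  shows "depth i t = - (int k + depth j t)"
proof -
  have "c t \<in> pverts G" using patrol by (simp add: lazy_walk_def)
  then show ?thesis
  proof (cases rule: T_verts_cases)
    case (Cyc a)
    then show ?thesis
      using assms cyc_dist_nonneg[of "j * k" "3 * k" a] leg_base_less by (auto simp: depth_def)
  next
    case (Leg h q)
    then show ?thesis using assms by (auto simp: depth_def split: if_splits)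
  qed
qed

text \<open>Between deep positions in two legs the patrol must climb out of one, follow at least
  \<open>k\<close> edges of the cycle and descend; \<open>\<rho> < l\<close> makes both depths
  positive.\<close>

lemma deep_gap:
  assumes "deep j m" "deep i n" "i < 3" "j < 3" "i \<noteq> j" "m \<le> n"
  shows "m + k < n"
proof -
  have "depth i m = - (int k + depth j m)"
    using assms radius_less_leg by (intro depth_other_leg) (auto simp: deep_def)
  then show ?thesis
    using depth_lipschitz'[OF assms(3), of n m] radius_less_leg assms by (auto simp: deep_def)
qed

section \<open>Hiding in a leg\<close>

lemma signed_depth_path_vertex: "j < 3 \<Longrightarrow> signed_depth k j (path_vertex k j q) = int q"
  by (simp add: path_vertex_def)

lemma hide_depth_le: "\<not> deep j t \<Longrightarrow> \<not> deep j (Suc t) \<Longrightarrow> hide_depth j t \<le> l"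
  by (auto simp: hide_depth_def deep_def)

lemma hide_in_verts: "j < 3 \<Longrightarrow> \<not> deep j t \<Longrightarrow> \<not> deep j (Suc t) \<Longrightarrow> hide j t \<in> pverts G"
  using hide_depth_le by (intro path_vertex_in_verts)

lemma uncaught_if_depth_diff:
  assumes "j < 3" "int \<rho> < \<bar>depth j t - signed_depth k j v\<bar>"
    "int \<rho> < \<bar>depth j (Suc t) - signed_depth k j v\<bar>"
  shows "uncaught t v"
  unfolding uncaught_def
  using assms gdist_gt[OF arc_lipschitz_signed_depth] by (simp add: depth_def)

lemma uncaught_hide:
  assumes "j < 3"
  shows "uncaught t (hide j t)"
  using assms
  by (intro uncaught_if_depth_diff[of j]) (auto simp: signed_depth_path_vertex hide_depth_def)

lemma step_path_vertex:
  assumes "j < 3" "q \<le> l" "q' \<le> l" "q' \<le> Suc q" "q \<le> Suc q'"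
  shows "(path_vertex k j q, path_vertex k j q') \<in> step G"
proof -
  consider "q = q'" | "q' = Suc q" | "q = Suc q'" using assms by linarith
  then show ?thesis
    using assms step_refl step_leg step_sym by cases auto
qed

lemma step_hide:
  assumes "j < 3" "\<not> deep j t" "\<not> deep j (Suc t)" "\<not> deep j (Suc (Suc t))"
  shows "(hide j t, hide j (Suc t)) \<in> step G"
proof (rule step_path_vertex)
  have "\<bar>depth j t - depth j (Suc t)\<bar> \<le> 1" "\<bar>depth j (Suc t) - depth j (Suc (Suc t))\<bar> \<le> 1"
    using depth_lipschitz'[OF assms(1)] by (metis abs_minus_commute abs_1 of_nat_Suc add_diff_cancel_right')+
  then show "hide_depth j (Suc t) \<le> Suc (hide_depth j t)" "hide_depth j t \<le> Suc (hide_depth j (Suc t))"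
    by (auto simp: hide_depth_def)
qed (use assms hide_depth_le in auto)

text \<open>While the patrol is deep in leg \<open>i\<close> around time \<open>T\<close>, the robber has just enough time to run
  from leg \<open>h\<close> to leg \<open>j\<close> along the opposite arc of the cycle: the run takes the \<open>k\<close> steps from
  \<open>T - (k + 1) div 2\<close> to \<open>T + k div 2\<close>.\<close>

definition lead :: nat where "lead = (k + 1) div 2"

definition lag :: nat where "lag = k div 2"

lemma lead_lag: "lead + lag = k" "0 < lead" "lag \<le> lead" "lead \<le> Suc lag"
  using k_pos by (auto simp: lead_def lag_def)

text \<open>Halving \<open>k\<close> loses nothing, by parity: for even \<open>k\<close> the bound
  \<open>4 * \<rho> + 3 \<le> 2 * l + k\<close> improves by one, and for odd \<open>k\<close> one
  has \<open>2 * lag = k - 1\<close>.\<close>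

lemma leg_depth_suffices: "2 * int \<rho> + 2 + int lag \<le> int l + int k"
  using radius_less by (simp add: lag_def)

text \<open>All these times are within \<open>lag + 1\<close> of \<open>T\<close>, since
  \<open>lead \<le> lag + 1\<close>. A patrol at such a depth is more than \<open>\<rho>\<close>
  away from the opposite arc, where the signed depth is at most \<open>- k\<close>.\<close>

lemma depth_near_deep:
  assumes "deep i T" "i < 3" "T \<le> t + lead" "t \<le> Suc (T + lag)"
  shows "int \<rho> + 1 - int k \<le> depth i t" "0 < depth i t"
proof -
  have "\<bar>depth i t - depth i T\<bar> \<le> int lag + 1"
    using depth_lipschitz'[OF assms(2), of t T] assms(3,4) lead_lag by auto
  then show "int \<rho> + 1 - int k \<le> depth i t"
    using assms(1) leg_depth_suffices by (simp add: deep_def)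
  then show "0 < depth i t" using radius_ge by linarith
qed

lemma hide_depth_near_deep:
  assumes "deep i T" "i < 3" "T \<le> t + lead" "t \<le> T + lag" "j < 3" "j \<noteq> i"
  shows "hide_depth j t = 0"
proof -
  have "depth j u = - (int k + depth i u)" "int \<rho> + 1 - int k \<le> depth i u" if "u = t \<or> u = Suc t" for u
    using depth_near_deep[of i T u] depth_other_leg[of i u j] assms that by auto
  from this[of t] this[of "Suc t"] show ?thesis by (simp add: hide_depth_def)
qed

text \<open>A sufficient condition for the robber to be possibly in leg \<open>j\<close> at time \<open>n\<close>: since the last deep
  visit to leg \<open>j\<close>, another leg has been visited deeply at least \<open>lag\<close> moves ago.\<close>

definition contaminated :: "nat \<Rightarrow> nat \<Rightarrow> bool" where
  "contaminated j n \<longleftrightarrow> (\<forall>m\<le>Suc n. deep j m \<longrightarrow>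
     (\<exists>i<3. \<exists>m'. i \<noteq> j \<and> m < m' \<and> m' + lag \<le> n \<and> deep i m'))"

lemma contaminated_not_deep:
  assumes "contaminated j n"
  shows "\<not> deep j n" "\<not> deep j (Suc n)"
  using assms unfolding contaminated_def by (metis Suc_n_not_le_n le_SucI le_add1 le_trans less_imp_le_nat linorder_not_le order_refl)+

text \<open>The run lasts from \<open>T - lead\<close> to \<open>T + lag\<close>;
  \<open>depth_near_deep\<close> covers these times and the one after, at which the patrol may also
  see the robber's last position.\<close>

lemma run_to_leg:
  assumes "i < 3" "j < 3" "h < 3" "i \<noteq> j" "i \<noteq> h" "j \<noteq> h" and deep: "deep i T"
    and n: "T + lag = n" "k \<le> n"
    and reach: "reachable_safely G uncaught (n - k) (Cyc (h * k))"
  shows "reachable_safely G uncaught n (Cyc (j * k))"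
proof -
  obtain f where f: "f 0 = Cyc (h * k)" "f k = Cyc (j * k)"
    "\<And>x. x < k \<Longrightarrow> (f x, f (Suc x)) \<in> step G"
    "\<And>x. x \<le> k \<Longrightarrow> f x \<in> pverts G \<and> signed_depth k i (f x) \<le> - int k"
    using opposite_arc[OF assms(1-6)] by metis
  have "reachable_safely G uncaught (n - k + x) (f x)" if "x \<le> k" for x
    using that
  proof (induction x)
    case 0
    then show ?case using reach f(1) by simp
  next
    case (Suc x)
    let ?t = "n - k + Suc x"
    have t: "T \<le> ?t + lead" "?t \<le> T + lag"
      using n lead_lag Suc.prems by auto
    have "int \<rho> + 1 - int k \<le> depth i ?t" "int \<rho> + 1 - int k \<le> depth i (Suc ?t)"
      using depth_near_deep(1)[OF deep assms(1)] t by auto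
    moreover have "signed_depth k i (f (Suc x)) \<le> - int k" using f(4) Suc.prems by blast
    ultimately have "uncaught ?t (f (Suc x))"
      by (intro uncaught_if_depth_diff[OF assms(1)]) auto
    then show ?case
      using Suc f(3)[of x] f(4)[of "Suc x"] reachable_safely_Suc[of G uncaught "n - k + x" "f x" "f (Suc x)"]
      by simp
  qed
  from this[of k] show ?thesis using f(2) n by simp
qed

text \<open>Strong induction on time: the robber either goes on hiding in leg \<open>j\<close> or,
  when leg \<open>j\<close> has just become contaminated, arrives from the third leg, which was
  contaminated \<open>k\<close> moves earlier.\<close>

lemma reachable_if_contaminated:
  assumes "contaminated j n" "j < 3"
  shows "reachable_safely G uncaught n (hide j n)"
  using assms
proof (induction n arbitrary: j rule: less_induct)
  case (less n)
  note not_deep = contaminated_not_deep[OF less.prems(1)]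
  show ?case
  proof (cases n)
    case 0
    then show ?thesis
      using not_deep less.prems by (auto intro!: reachable_safely_0 hide_in_verts uncaught_hide)
  next
    case (Suc n')
    show ?thesis
    proof (cases "contaminated j n'")
      case True
      then have "reachable_safely G uncaught n' (hide j n')" using less Suc by blast
      then show ?thesis
        using not_deep contaminated_not_deep[OF True] less.prems Suc
        by (auto intro!: reachable_safely_Suc step_hide hide_in_verts uncaught_hide)
    next
      case False
      \<comment> \<open>The visit at \<open>m\<close> has no witness at time \<open>n'\<close> but
        has one, \<open>T\<close>, at time \<open>n\<close>; so \<open>T\<close> is exactly
        \<open>lag\<close> moves old.\<close>
      then obtain m where m: "m \<le> n" "deep j m"
        and least: "\<And>i m'. i < 3 \<Longrightarrow> i \<noteq> j \<Longrightarrow> m < m' \<Longrightarrow> m' + lag \<le> n' \<Longrightarrow> \<not> deep i m'"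
        unfolding contaminated_def Suc by blast
      then obtain i T where i: "i < 3" "i \<noteq> j" "m < T" "T + lag \<le> n" "deep i T"
        using less.prems(1) unfolding contaminated_def by (meson le_SucI)
      then have T: "T + lag = n" using least[of i T] Suc by linarith
      define h where "h = 3 - i - j"
      have "i = 0 \<or> i = 1 \<or> i = 2" "j = 0 \<or> j = 1 \<or> j = 2" using i less.prems by auto
      then have h: "h < 3" "i \<noteq> h" "j \<noteq> h" using i(2) unfolding h_def by auto
      have gap: "m + k < T"
        using deep_gap[OF m(2) i(5) i(1) less.prems(2) i(2) less_imp_le[OF i(3)]] radius_less_leg by linarith
      have excl: "\<not> deep h t" if "deep p t" "p < 3" "p \<noteq> h" for p t
        using deep_gap[of p t h t] that h radius_less_leg k_pos by auto
      \<comment> \<open>A deep visit to \<open>h\<close> between \<open>m\<close> and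
        \<open>T\<close> would have been a witness for \<open>j\<close> already at
        \<open>n'\<close>. So all those in question precede \<open>m\<close>, and the visit to
        \<open>j\<close> at \<open>m\<close> is the witness for \<open>h\<close>.\<close>
      have "contaminated h (n - k)"
        unfolding contaminated_def
      proof (intro allI impI)
        fix m2 assume m2: "m2 \<le> Suc (n - k)" "deep h m2"
        have "m2 \<noteq> m" "m2 \<noteq> T" using excl m2 m i less.prems h by metis+
        moreover have "m2 \<le> T" using m2 T gap lead_lag by linarith
        ultimately have "m2 < m" using least[of h m2] m2 h T Suc by (metis Suc_leI linorder_neqE_nat add_Suc Suc_le_mono add_le_mono1 le_neq_implies_less)
        then show "\<exists>i<3. \<exists>m'. i \<noteq> h \<and> m2 < m' \<and> m' + lag \<le> n - k \<and> deep i m'"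
          using m less.prems h T gap by (intro exI[of _ j] conjI exI[of _ m]) auto
      qed
      then have "reachable_safely G uncaught (n - k) (hide h (n - k))"
        using less.IH[of "n - k" h] h k_pos Suc by simp
      moreover have "hide_depth h (n - k) = 0"
        using T gap lead_lag i h by (intro hide_depth_near_deep[of i T]) auto
      ultimately have "reachable_safely G uncaught n (Cyc (j * k))"
        using run_to_leg[of i j h T n] i h T gap less.prems by simp
      moreover have "hide_depth j n = 0"
        using T i less.prems by (intro hide_depth_near_deep[of i T]) auto
      ultimately show ?thesis by simp
    qed
  qed
qed

text \<open>If all legs have been visited deeply, order their last deep visits. The leg with the
  earliest one is contaminated by the middle one, which is more than \<open>k\<close> moves before
  the latest and hence at least \<open>lag\<close> moves old.\<close>

lemma ex_contaminated: "\<exists>j<3. contaminated j n"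
proof (cases "\<exists>j<3. \<forall>m\<le>Suc n. \<not> deep j m")
  case True
  then show ?thesis by (auto simp: contaminated_def)
next
  case False
  define M where "M j = Max {m. m \<le> Suc n \<and> deep j m}" for j
  have M: "M j \<le> Suc n" "deep j (M j)" "\<And>m. m \<le> Suc n \<Longrightarrow> deep j m \<Longrightarrow> m \<le> M j" if "j < 3" for j
  proof -
    have fin: "finite {m. m \<le> Suc n \<and> deep j m}" by simp
    have "{m. m \<le> Suc n \<and> deep j m} \<noteq> {}" using False that by blast
    from Max_in[OF fin this] Max_ge[OF fin]
    show "M j \<le> Suc n" "deep j (M j)" "\<And>m. m \<le> Suc n \<Longrightarrow> deep j m \<Longrightarrow> m \<le> M j"
      by (auto simp: M_def)
  qed
  have "\<exists>j i p. j < 3 \<and> i < 3 \<and> p < 3 \<and> j \<noteq> i \<and> i \<noteq> p \<and> M j \<le> M i \<and> M i \<le> M p"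
  proof -
    have *: "0 < (3::nat)" "1 < (3::nat)" "2 < (3::nat)" "(0::nat) \<noteq> 1" "(0::nat) \<noteq> 2" "(1::nat) \<noteq> 2" by auto
    then show ?thesis by (metis linorder_linear)
  qed
  then obtain j i p where jip: "j < 3" "i < 3" "p < 3" "j \<noteq> i" "i \<noteq> p" "M j \<le> M i" "M i \<le> M p"
    by blast
  have "M j < M i"
    using deep_gap[OF M(2)[OF jip(1)] M(2)[OF jip(2)] jip(2,1) jip(4)[symmetric] jip(6)]
      k_pos radius_less_leg by linarith
  moreover have "M i + lag \<le> n"
    using deep_gap[OF M(2)[OF jip(2)] M(2)[OF jip(3)] jip(3,2) jip(5)[symmetric] jip(7)]
      M(1)[OF jip(3)] radius_less_leg lead_lag by linarith
  ultimately have "contaminated j n"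
    unfolding contaminated_def using M(2)[OF jip(2)] M(3)[OF jip(1)] jip(2,4)
    by (intro allI impI exI[of _ i] exI[of _ "M i"] conjI) (auto intro: le_less_trans)
  then show ?thesis using jip by blast
qed

lemma not_winning: "\<not> winning_patrol G \<rho> c"
proof
  assume "winning_patrol G \<rho> c"
  moreover obtain r where "lazy_walk G r" "\<And>t. uncaught t (r t)"
    using koenig_safe_walk[OF finite_T_verts, of k l uncaught]
      ex_contaminated reachable_if_contaminated by metis
  ultimately show False
    unfolding winning_patrol_def capture_def uncaught_def by blast
qed

end

section \<open>A winning patrol\<close>

definition on_leg :: "nat \<Rightarrow> tvertex \<Rightarrow> bool" where
  "on_leg j v \<longleftrightarrow> (\<exists>q. v = Leg j q)"

context cycle_with_legs
begin

lemma on_leg_step: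
  assumes "(u, v) \<in> step G" "on_leg j u"
  shows "on_leg j v \<or> v = Cyc (j * k)"
  using assms step_from_Leg unfolding on_leg_def by blast

end

locale sweep = cycle_with_legs +
  fixes \<rho> :: nat
  assumes radius_ge_leg: "2 * l + k \<le> 4 * \<rho> + 2"
    and radius_ge_cycle: "3 * k \<le> 2 * \<rho> + 2"
begin

text \<open>The least depth from which the end of a leg is within distance \<open>\<rho>\<close>; it is \<open>0\<close> if \<open>l \<le> \<rho>\<close>.\<close>

definition dip :: nat where "dip = l - \<rho>"

lemma k_le_radius: "k \<le> \<rho>"
  using radius_ge_cycle k_pos by linarith

lemma dip_bounds: "dip \<le> \<rho>" "dip \<le> l" "l \<le> dip + \<rho>"
  using radius_ge_leg k_pos by (auto simp: dip_def)

text \<open>Starting at depth \<open>dip\<close> makes leg 2 clear at once. The arc between the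
  bases of legs 1 and 2 is never walked; timing during the visit to leg 0 closes it to the
  robber.\<close>

definition patrol :: "nat \<Rightarrow> tvertex" where
  "patrol t =
     (if t < dip then path_vertex k 2 (dip - t)
      else if t < dip + k then Cyc (2 * k + (t - dip))
      else if t < 2 * dip + k then path_vertex k 0 (t - (dip + k))
      else if t < 3 * dip + k then path_vertex k 0 (3 * dip + k - t)
      else if t < 3 * dip + 2 * k then Cyc (t - (3 * dip + k))
      else path_vertex k 1 (min dip (t - (3 * dip + 2 * k))))"

lemma patrol_leg2: "t \<le> dip \<Longrightarrow> patrol t = path_vertex k 2 (dip - t)"
  using k_pos by (auto simp: patrol_def)

lemma patrol_arc2: "i \<le> k \<Longrightarrow> patrol (dip + i) = Cyc ((2 * k + i) mod (3 * k))"
  using k_pos by (cases "i = k"; cases "dip = 0") (auto simp: patrol_def)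

definition dip_depth :: "nat \<Rightarrow> nat" where
  "dip_depth i = (if i \<le> dip then i else 2 * dip - i)"

lemma patrol_leg0: "i \<le> 2 * dip \<Longrightarrow> patrol (dip + k + i) = path_vertex k 0 (dip_depth i)"
  using k_pos by (auto simp: patrol_def dip_depth_def)

lemma dip_depth_bounds: "i \<le> 2 * dip \<Longrightarrow> dip_depth i \<le> i \<and> dip_depth i \<le> 2 * dip - i \<and> dip_depth i \<le> dip"
  by (auto simp: dip_depth_def)

lemma patrol_arc0: "i \<le> k \<Longrightarrow> patrol (3 * dip + k + i) = Cyc i"
  using k_pos by (auto simp: patrol_def)

lemma patrol_leg1: "patrol (3 * dip + 2 * k + i) = path_vertex k 1 (min dip i)"
  by (auto simp: patrol_def)

lemma lazy_walk_patrol: "lazy_walk G patrol"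
  unfolding lazy_walk_iff
proof (intro conjI allI)
  fix t
  show "patrol t \<in> pverts G"
    using k_pos dip_bounds unfolding patrol_def
    by (auto intro!: cyc_in_verts path_vertex_in_verts simp del: path_vertex_pos)
  have down: "(path_vertex k j e, path_vertex k j (Suc e)) \<in> step G" if "j < 3" "e < dip" for j e
    using that dip_bounds by (intro step_leg) auto
  have up: "(path_vertex k j (Suc e), path_vertex k j e) \<in> step G" if "j < 3" "e < dip" for j e
    using step_sym[OF down] that by blast
  consider (leg2) "t < dip" | (arc2) i where "t = dip + i" "i < k"
    | (leg0) i where "t = dip + k + i" "i < 2 * dip"
    | (arc0) i where "t = 3 * dip + k + i" "i < k"
    | (leg1) i where "t = 3 * dip + 2 * k + i"
  proof -
    assume a: "t < dip \<Longrightarrow> thesis" "\<And>i. t = dip + i \<Longrightarrow> i < k \<Longrightarrow> thesis"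
      "\<And>i. t = dip + k + i \<Longrightarrow> i < 2 * dip \<Longrightarrow> thesis"
      "\<And>i. t = 3 * dip + k + i \<Longrightarrow> i < k \<Longrightarrow> thesis" "\<And>i. t = 3 * dip + 2 * k + i \<Longrightarrow> thesis"
    show thesis
      using a(1) a(2)[of "t - dip"] a(3)[of "t - (dip + k)"] a(4)[of "t - (3 * dip + k)"]
        a(5)[of "t - (3 * dip + 2 * k)"] by linarith
  qed
  then show "(patrol t, patrol (Suc t)) \<in> step G"
  proof cases
    case leg2
    then show ?thesis using up[of 2 "dip - Suc t"] by (simp add: patrol_leg2 Suc_diff_Suc)
  next
    case (arc2 i)
    then show ?thesis
      using patrol_arc2[of i] patrol_arc2[of "Suc i"] k_pos
        step_cyc[OF cyc_adj_Suc_mod, of "(2 * k + i) mod (3 * k)"]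
      by (simp add: mod_Suc_eq)
  next
    case (leg0 i)
    have "dip_depth (Suc i) = Suc (dip_depth i) \<and> dip_depth i < dip
      \<or> dip_depth i = Suc (dip_depth (Suc i)) \<and> dip_depth (Suc i) < dip"
      using leg0(2) by (auto simp: dip_depth_def)
    then show ?thesis
      using leg0 patrol_leg0[of i] patrol_leg0[of "Suc i"] down[of 0] up[of 0] by auto
  next
    case (arc0 i)
    then show ?thesis
      using patrol_arc0[of i] patrol_arc0[of "Suc i"] by (simp add: step_cyc cyc_adj_def)
  next
    case (leg1 i)
    then show ?thesis
      using patrol_leg1[of i] patrol_leg1[of "Suc i"] down[of 1 i] step_refl
      by (cases "i < dip") auto
  qed
qed

text \<open>If \<open>b\<close> were farther than \<open>\<rho>\<close> from both ends of the edge,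
  the rest of the cycle would have at least \<open>2 * (\<rho> + 1)\<close> edges, so that
  \<open>3 * k \<ge> 2 * \<rho> + 3\<close>.\<close>

lemma near_one_of_two:
  assumes "cyc_adj (3 * k) x y" "x < 3 * k" "y < 3 * k" "b < 3 * k"
  shows "cyc_dist (3 * k) x b \<le> int \<rho> \<or> cyc_dist (3 * k) y b \<le> int \<rho>"
  using assms radius_ge_cycle unfolding cyc_adj_def cyc_dist_def
  by (elim disjE conjE; simp add: min_def abs_if; linarith)

end

section \<open>A hypothetical robber who survives the sweep\<close>

locale evasion = sweep +
  fixes r :: "nat \<Rightarrow> tvertex"
  assumes robber: "lazy_walk G r" and not_captured: "\<not> capture G \<rho> patrol r"
begin

lemma robber_step: "(r t, r (Suc t)) \<in> step G"
  using robber by (simp add: lazy_walk_iff)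

lemma robber_in_verts: "r t \<in> pverts G"
  using robber by (simp add: lazy_walk_iff)

lemma far: "u = t \<or> u = Suc t \<Longrightarrow> \<not> gdist G (patrol u) (r t) \<le> ereal (real \<rho>)"
  using not_captured unfolding capture_def by blast

lemma far_from_leg:
  assumes "patrol u = path_vertex k j e" "u = t \<or> u = Suc t" "j < 3" "e \<le> dip" "b < 3 * k"
    "int e + cyc_dist (3 * k) (j * k) b \<le> int \<rho>"
  shows "r t \<noteq> Cyc b"
  using gdist_leg_cyc[of j e b \<rho>] far[of u t] assms dip_bounds by auto

text \<open>From depth \<open>dip\<close> the whole leg is within reach: towards the base as
  \<open>dip \<le> \<rho>\<close>, towards the end as \<open>l \<le> dip + \<rho>\<close>.\<close>

lemma not_on_leg_at_dip:
  assumes "patrol t = path_vertex k j dip" "j < 3"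
  shows "\<not> on_leg j (r t)"
proof
  assume "on_leg j (r t)"
  then obtain q where "r t = Leg j q" "0 < q" "q \<le> l"
    using robber_in_verts[of t] by (auto simp: on_leg_def elim!: T_verts_cases)
  then have "r t = path_vertex k j q" by simp
  then show False
    using gdist_leg_leg[of j dip q \<rho>] far[of t t] assms dip_bounds \<open>q \<le> l\<close> by auto
qed

lemma far_from_base:
  assumes "patrol t = path_vertex k j e" "j < 3" "e \<le> dip"
  shows "r t \<noteq> Cyc (j * k)"
  using far_from_leg[of t j e t "j * k"] assms leg_base_less dip_bounds by simp

text \<open>As \<open>dip \<le> \<rho>\<close>, a patrol inside the leg guards the base, the only
  way in or out.\<close>

lemma stays_on_leg:
  assumes "patrol (Suc t) = path_vertex k j e" "j < 3" "e \<le> dip" "on_leg j (r t)"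
  shows "on_leg j (r (Suc t))"
  using on_leg_step[OF robber_step assms(4)] far_from_base[OF assms(1-3)] by blast

lemma stays_off_leg:
  assumes "patrol t = path_vertex k j e" "j < 3" "e \<le> dip" "\<not> on_leg j (r t)"
  shows "\<not> on_leg j (r (Suc t))"
  using on_leg_step[OF step_sym[OF robber_step]] far_from_base[OF assms(1-3)] assms(4) by blast

lemma caught_at_dip:
  assumes "\<And>i. i \<le> dip \<Longrightarrow> patrol (t + i) = path_vertex k j i" "j < 3"
  shows "\<not> on_leg j (r t)"
proof
  assume leg: "on_leg j (r t)"
  have "on_leg j (r (t + i))" if "i \<le> dip" for i
    using that
  proof (induction i)
    case (Suc i)
    then show ?case
      using stays_on_leg[of "t + i" j "Suc i"] assms(1)[of "Suc i"] assms(2) by simp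
  qed (use leg in simp)
  from this[of dip] show False
    using not_on_leg_at_dip[of "t + dip" j] assms by simp
qed

lemma moving_patrol_clears_cycle:
  assumes "patrol t = Cyc x" "patrol (Suc t) = Cyc y" "cyc_adj (3 * k) x y" "x < 3 * k" "y < 3 * k"
  obtains j where "j < 3" "on_leg j (r t)"
proof (cases rule: T_verts_cases[OF robber_in_verts[of t]])
  case (1 b)
  then show ?thesis
    using near_one_of_two[OF assms(3-5) 1(2)] gdist_cyc_cyc[of x b \<rho>] gdist_cyc_cyc[of y b \<rho>]
      far[of t t] far[of "Suc t" t] assms by auto
next
  case (2 j q)
  then show ?thesis using that by (auto simp: on_leg_def)
qed

lemma not_on_leg_2: "i \<le> dip \<Longrightarrow> \<not> on_leg 2 (r i)"
proof (induction i)
  case 0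
  then show ?case using not_on_leg_at_dip[of 0 2] patrol_leg2[of 0] by simp
next
  case (Suc i)
  then show ?case using stays_off_leg[of i 2 "dip - i"] patrol_leg2[of i] by simp
qed

lemma arc2_on_leg:
  assumes "i < k"
  obtains j where "j < 3" "on_leg j (r (dip + i))"
proof -
  have *: "cyc_adj (3 * k) ((2 * k + i) mod (3 * k)) ((2 * k + Suc i) mod (3 * k))"
    using cyc_adj_Suc_mod[of "(2 * k + i) mod (3 * k)" "3 * k"] k_pos by (simp add: mod_Suc_eq)
  show thesis
    using moving_patrol_clears_cycle[OF _ _ *] patrol_arc2[of i] patrol_arc2[of "Suc i"] assms that
      k_pos by auto
qed

text \<open>While the patrol moves along the arc the robber is on some leg at every time, and no
  single step leads from one leg to another.\<close>

lemma arc2_not_on_leg_2: "i \<le> k \<Longrightarrow> \<not> on_leg 2 (r (dip + i))"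
proof (induction i)
  case 0
  then show ?case using not_on_leg_2[of dip] by simp
next
  case (Suc i)
  then obtain j where "on_leg j (r (dip + i))" using arc2_on_leg[of i] by auto
  then show ?case
    using Suc on_leg_step[OF step_sym[OF robber_step[of "dip + i"]], of 2]
    by (auto simp: on_leg_def)
qed

text \<open>On arrival at base 0 the patrol has every base within \<open>k \<le> \<rho>\<close>, so
  the robber's last step did not take him off his leg.\<close>

lemma on_leg_0_or_1: "on_leg 0 (r (dip + k)) \<or> on_leg 1 (r (dip + k))"
proof -
  obtain j where j: "j < 3" "on_leg j (r (dip + (k - 1)))"
    using arc2_on_leg[of "k - 1"] k_pos by auto
  then have "j \<noteq> 2" using arc2_not_on_leg_2[of "k - 1"] by auto
  have "on_leg j (r (dip + k)) \<or> r (dip + k) = Cyc (j * k)"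
    using on_leg_step[OF robber_step j(2)] k_pos by simp
  moreover have "r (dip + k) \<noteq> Cyc (j * k)"
    using far_from_leg[of "dip + k" 0 0 "dip + k" "j * k"] patrol_leg0[of 0] j(1) \<open>j \<noteq> 2\<close>
      cyc_dist_leg_bases[of 0 j] leg_base_less[OF j(1)] k_le_radius
    by (cases "j = 0") (auto simp: dip_depth_def)
  ultimately show ?thesis using j(1) \<open>j \<noteq> 2\<close> by (auto simp: less_Suc_eq numeral_3_eq_3 numeral_2_eq_2)
qed

lemma on_leg_1: "on_leg 1 (r (dip + k))"
proof -
  have "\<not> on_leg 0 (r (dip + k))"
    by (rule caught_at_dip) (simp_all add: patrol_leg0 dip_depth_def)
  then show ?thesis using on_leg_0_or_1 by blast
qed

text \<open>During the visit to leg 0 the robber can leave leg 1 only once the patrol is at depth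
  \<open>\<rho> - k + 1\<close>, and from then on he gains at most one vertex per move on the arc towards leg 2.\<close>

definition confined :: "nat \<Rightarrow> tvertex \<Rightarrow> bool" where
  "confined i v \<longleftrightarrow> on_leg 1 v \<or>
     (\<exists>a. v = Cyc a \<and> 0 < a \<and> a < 2 * k \<and> (k \<le> a \<longrightarrow> a + \<rho> + 1 \<le> 2 * k + i))"

lemma far_during_dip:
  assumes "i \<le> 2 * dip" "dip + k + i = t \<or> dip + k + i = Suc t"
  shows "r t \<noteq> Cyc 0" "r t = Cyc k \<Longrightarrow> \<rho> < dip_depth i + k" "r t = Cyc (2 * k) \<Longrightarrow> \<rho> < dip_depth i + k"
proof -
  have d: "dip_depth i \<le> dip" using dip_depth_bounds[OF assms(1)] by simp
  have *: "r t \<noteq> Cyc b" if "b < 3 * k" "int (dip_depth i) + cyc_dist (3 * k) 0 b \<le> int \<rho>" for b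
    using far_from_leg[OF patrol_leg0[OF assms(1)] assms(2), of b] d that by simp
  show "r t \<noteq> Cyc 0" using *[of 0] d dip_bounds k_pos by simp
  have base: "r t \<noteq> Cyc (j * k)" if "dip_depth i + k \<le> \<rho>" "j < 3" "0 < j" for j
    using *[OF leg_base_less[OF that(2)]] cyc_dist_leg_bases[of 0 j] that by simp
  show "r t = Cyc k \<Longrightarrow> \<rho> < dip_depth i + k" "r t = Cyc (2 * k) \<Longrightarrow> \<rho> < dip_depth i + k"
    using base[of 1] base[of 2] by (auto simp: not_less[symmetric])
qed

lemma not_through_arc:
  assumes "Suc i \<le> 2 * dip" "\<rho> \<le> i"
  shows "r (dip + k + Suc i) \<noteq> Cyc (2 * k)"
proof
  assume at: "r (dip + k + Suc i) = Cyc (2 * k)"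
  show False
  proof (cases "Suc i = 2 * dip")
    case True
    then show False
      using far_during_dip(3)[OF assms(1) _ at] dip_depth_bounds[OF assms(1)] k_le_radius by simp
  next
    case False
    then have i: "Suc (Suc i) \<le> 2 * dip" using assms by simp
    \<comment> \<open>The binding constraint is the patrol's following position, already at depth at
      most \<open>2 * dip - \<rho> - 2\<close>. Missing base 2 from there would mean
      \<open>4 * \<rho> + 2 < 2 * l + k\<close>.\<close>
    then have "\<rho> < dip_depth (Suc (Suc i)) + k"
      using far_during_dip(3)[OF i _ at] by simp
    then have "2 * \<rho> + 2 < 2 * dip + k"
      using dip_depth_bounds[OF i] assms i by linarith
    then show False using radius_ge_leg i by (simp add: dip_def)
  qed
qed

lemma confined_during_dip: "i \<le> 2 * dip \<Longrightarrow> confined i (r (dip + k + i))"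
proof (induction i)
  case 0
  then show ?case using on_leg_1 by (simp add: confined_def)
next
  case (Suc i)
  define u where "u = r (dip + k + i)"
  define w where "w = r (dip + k + Suc i)"
  have step: "(u, w) \<in> step G" using robber_step[of "dip + k + i"] by (simp add: u_def w_def)
  have w0: "w \<noteq> Cyc 0" using far_during_dip(1)[OF Suc.prems] by (auto simp: w_def)
  \<comment> \<open>Leaving leg 1 at index \<open>i + 1\<close> takes a patrol depth above
    \<open>\<rho> - k\<close>, and that depth is at most \<open>i + 1\<close>. This is the bound in
    \<open>confined\<close> for \<open>a = k\<close>.\<close>
  have wk: "w = Cyc k \<Longrightarrow> confined (Suc i) w"
    using far_during_dip(2)[OF Suc.prems, of "dip + k + Suc i"] dip_depth_bounds[OF Suc.prems] k_pos
    by (auto simp: w_def confined_def)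
  consider "on_leg 1 u" | a where "u = Cyc a" "0 < a" "a < 2 * k" "k \<le> a \<longrightarrow> a + \<rho> + 1 \<le> 2 * k + i"
    using Suc by (auto simp: confined_def u_def)
  then show ?case
    unfolding w_def[symmetric]
  proof cases
    case 1
    then show "confined (Suc i) w" using on_leg_step[OF step 1] wk by (auto simp: confined_def)
  next
    case (2 a)
    from step_from_Cyc[OF step[unfolded 2(1)]]
    consider "w = Cyc a" | b where "w = Cyc b" "b = Suc a \<or> a = Suc b" | j where "a = j * k" "w = Leg j 1"
      using 2(2,3) by (auto simp: cyc_adj_def)
    then show "confined (Suc i) w"
    proof cases
      case 1
      then show ?thesis using 2 by (auto simp: confined_def)
    next
      case (2 b)
      note a = \<open>0 < a\<close> \<open>a < 2 * k\<close> \<open>k \<le> a \<longrightarrow> a + \<rho> + 1 \<le> 2 * k + i\<close>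
      have "0 < b" using w0 2(1) by (cases b) auto
      moreover have "b < 2 * k"
      proof (rule ccontr)
        assume "\<not> b < 2 * k"
        \<comment> \<open>Here \<open>a = 2 * k - 1\<close>, for which the bound in
          \<open>confined\<close> reads \<open>\<rho> \<le> i\<close>.\<close>
        then have "b = 2 * k" "\<rho> \<le> i" using 2(2) a by auto
        then show False using not_through_arc[OF Suc.prems] 2(1) by (simp add: w_def)
      qed
      ultimately show ?thesis
        using 2 a wk by (cases "b = k") (auto simp: confined_def)
    next
      case (3 j)
      then have "j = 1" using 2(2,3) k_pos by (cases j) auto
      then show ?thesis using 3 by (simp add: confined_def on_leg_def)
    qed
  qed
qed

text \<open>The first step along the arc clears the cycle, so a confined robber is on leg 1. From
  then on its base stays within \<open>k \<le> \<rho>\<close> of the patrol.\<close>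

lemma arc0_on_leg_1: "i \<le> k \<Longrightarrow> on_leg 1 (r (3 * dip + k + i))"
proof (induction i)
  case 0
  have "confined (2 * dip) (r (3 * dip + k))"
    using confined_during_dip[of "2 * dip"] by (simp add: algebra_simps)
  moreover obtain j where "j < 3" "on_leg j (r (3 * dip + k))"
    using moving_patrol_clears_cycle[of "3 * dip + k" 0 1] patrol_arc0[of 0] patrol_arc0[of 1] k_pos
    by (auto simp: cyc_adj_def)
  ultimately show ?case by (auto simp: confined_def on_leg_def)
next
  case (Suc i)
  have "cyc_dist (3 * k) (Suc i) k \<le> int \<rho>"
    using Suc.prems k_le_radius by (auto simp: cyc_dist_def)
  then have "r (3 * dip + k + Suc i) \<noteq> Cyc k"
    using gdist_cyc_cyc[of "Suc i" k \<rho>] far[of "3 * dip + k + Suc i" "3 * dip + k + Suc i"]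
      patrol_arc0[of "Suc i"] Suc.prems k_pos by auto
  then show ?case
    using Suc on_leg_step[OF robber_step, of 1 "3 * dip + k + i"] by simp
qed

lemma no_evasion: False
proof -
  have "\<not> on_leg 1 (r (3 * dip + 2 * k))"
    using patrol_leg1 by (intro caught_at_dip) auto
  then show False using arc0_on_leg_1[of k] by (simp add: algebra_simps)
qed

end

lemma (in sweep) winning_patrol: "winning_patrol G \<rho> patrol"
proof -
  have "capture G \<rho> patrol r" if "lazy_walk G r" for r
  proof (rule ccontr)
    assume "\<not> capture G \<rho> patrol r"
    then interpret evasion k l \<rho> r using that by unfold_locales
    show False by (rule no_evasion)
  qed
  then show ?thesis using lazy_walk_patrol by (simp add: winning_patrol_def)
qed

section \<open>The radius as the least solution of the two inequalities\<close>

theorem theorem5: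
  fixes k l :: nat
  assumes "k > 0" and "l > 0"
  shows "int (patrol_radius (T_graph k l)) =
    max \<lceil>real l / 2 + (real k - 2) / 4\<rceil> \<lceil>(3 * real k - 2) / 2\<rceil>"
proof -
  interpret cycle_with_legs k l using assms by unfold_locales
  have winning_iff: "(\<exists>c. winning_patrol G \<rho> c) \<longleftrightarrow> 2 * l + k \<le> 4 * \<rho> + 2 \<and> 3 * k \<le> 2 * \<rho> + 2" for \<rho>
  proof
    assume "\<exists>c. winning_patrol G \<rho> c"
    then obtain c where win: "winning_patrol G \<rho> c" by blast
    have cycle: "3 * k \<le> 2 * \<rho> + 2"
      using not_winning_if_small_on_cycle[of \<rho> c] win by linarith
    moreover have "2 * l + k \<le> 4 * \<rho> + 2"
    proof (rule ccontr)
      assume "\<not> 2 * l + k \<le> 4 * \<rho> + 2"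
      then interpret long_legs_patrol k l \<rho> c
        using win cycle by unfold_locales (auto simp: winning_patrol_def)
      show False using not_winning win by blast
    qed
    ultimately show "2 * l + k \<le> 4 * \<rho> + 2 \<and> 3 * k \<le> 2 * \<rho> + 2" by blast
  next
    assume "2 * l + k \<le> 4 * \<rho> + 2 \<and> 3 * k \<le> 2 * \<rho> + 2"
    then interpret sweep k l \<rho> by unfold_locales auto
    show "\<exists>c. winning_patrol G \<rho> c" using winning_patrol by blast
  qed
  define N where "N = max \<lceil>real l / 2 + (real k - 2) / 4\<rceil> \<lceil>(3 * real k - 2) / 2\<rceil>"
  have N_le: "N \<le> int \<rho> \<longleftrightarrow> (\<exists>c. winning_patrol G \<rho> c)" for \<rho>
  proof -
    have "N \<le> int \<rho> \<longleftrightarrow> real l / 2 + (real k - 2) / 4 \<le> real \<rho> \<and> (3 * real k - 2) / 2 \<le> real \<rho>"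
      by (simp add: N_def ceiling_le_iff)
    also have "\<dots> \<longleftrightarrow> real (2 * l + k) \<le> real (4 * \<rho> + 2) \<and> real (3 * k) \<le> real (2 * \<rho> + 2)"
      by (auto simp: field_simps)
    finally show ?thesis by (simp only: winning_iff of_nat_le_iff)
  qed
  \<comment> \<open>Nonnegativity of \<open>N\<close> lets \<open>nat N\<close> stand for it as a
    radius.\<close>
  have "0 \<le> \<lceil>(3 * real k - 2) / 2\<rceil>" using assms by simp
  then have "0 \<le> N" unfolding N_def by linarith
  moreover have "patrol_radius G = nat N"
    unfolding patrol_radius_def using \<open>0 \<le> N\<close>
    by (intro Least_equality) (simp_all flip: N_le add: nat_le_iff)
  ultimately show ?thesis by (simp add: N_def)
qed

end
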